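(* Let $\Gamma=\langle\alpha_1,\ldots,\alpha_k\rangle\subset\mathbb N^d$ be an affine semigroup and $\gamma\in\Gamma$. For each $i\le k$ with $\gamma-\alpha_i\in\Gamma$, let $T_i\subseteq K_\gamma$ be the image, under the cover morphism $\psi_i:K_{\gamma-\alpha_i}\to K_\gamma$, of a minimum weight spanning tree of $K_{\gamma-\alpha_i}$; for $i$ with $\gamma-\alpha_i\notin\Gamma$ let $E(T_i)=\emptyset$. Let $E'$ be the set of elements $(z,w)$ of the Graver basis of $\Gamma$ with $z,w\in\mathsf Z(\gamma)$, viewed as edges of $K_\gamma$. Then the graph $G'=(\mathsf Z(\gamma),E(T_1)\cup\cdots\cup E(T_k)\cup E')$ is connected, and every minimum weight spanning tree of $G'$ is a minimum weight spanning tree of $K_\gamma$.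
   Context: An affine semigroup is a finitely generated submonoid of $\mathbb N^d$ with minimal generating set $\alpha_1,\ldots,\alpha_k$; $\varphi_\Gamma(z)=z_1\alpha_1+\cdots+z_k\alpha_k$ for $z\in\mathbb N^k$, $\mathsf Z(\gamma)=\varphi_\Gamma^{-1}(\gamma)$, and $|z|=z_1+\cdots+z_k$. For $z,w\in\mathbb N^k$, $\gcd(z,w)=(\min(z_1,w_1),\ldots,\min(z_k,w_k))$ and $\mathrm{dist}(z,w)=\max(|z-\gcd(z,w)|,|w-\gcd(z,w)|)$. The catenary graph $K_\gamma$ is the complete graph on $\mathsf Z(\gamma)$ with each edge $\{z,w\}$ labeled $\mathrm{dist}(z,w)$; subgraphs inherit these labels. The cover morphism $\psi_i:K_{\gamma-\alpha_i}\to K_\gamma$ sends each vertex $z\in\mathsf Z(\gamma-\alpha_i)$ to $z+e_i$ ($e_i$ the $i$-th unit vector) and each edge $\{z,w\}$ to $\{z+e_i,w+e_i\}$. In an edge-labeled graph, the weight of a chain $v_0,\ldots,v_r$ (consecutive vertices adjacent) is its largest edge label; a spanning tree $T$ is of minimum weight if, for any two vertices, the unique path between them in $T$ has minimum weight among all chains in the graph joining them. The Graver basis of $\Gamma$ is the minimal generating set (Hilbert basis) of the affine semigroup $\{(z,w)\in\mathbb N^k\times\mathbb N^k:\varphi_\Gamma(z)=\varphi_\Gamma(w)\}$. *)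

theory Defs
  imports Complex_Main "HOL-Library.Function_Algebras" "HOL-Library.Product_Plus"
begin

(* N^n is the set of functions nat => nat vanishing outside {..<n}; in this way n = 0 is allowed. *)
definition nvec :: "nat \<Rightarrow> (nat \<Rightarrow> nat) set" where
  "nvec n = {v. \<forall>i\<ge>n. v i = 0}"

definition add_submonoid :: "'a::comm_monoid_add set \<Rightarrow> bool" where
  "add_submonoid M \<longleftrightarrow> 0 \<in> M \<and> (\<forall>x\<in>M. \<forall>y\<in>M. x + y \<in> M)"

definition minimal_generating_set :: "'a::comm_monoid_add set \<Rightarrow> 'a set \<Rightarrow> bool" where
  "minimal_generating_set B M \<longleftrightarrow>
     add_submonoid hull B = M \<and> (\<forall>A. A \<subset> B \<longrightarrow> add_submonoid hull A \<noteq> M)"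

definition affine_semigroup :: "nat \<Rightarrow> (nat \<Rightarrow> nat) set \<Rightarrow> bool" where
  "affine_semigroup d M \<longleftrightarrow>
     add_submonoid M \<and> M \<subseteq> nvec d \<and> (\<exists>A. finite A \<and> add_submonoid hull A = M)"

definition fact_hom :: "nat \<Rightarrow> (nat \<Rightarrow> nat \<Rightarrow> nat) \<Rightarrow> (nat \<Rightarrow> nat) \<Rightarrow> (nat \<Rightarrow> nat)" where
  "fact_hom k \<alpha> z = (\<lambda>j. \<Sum>i<k. z i * \<alpha> i j)"

definition factorizations :: "nat \<Rightarrow> (nat \<Rightarrow> nat \<Rightarrow> nat) \<Rightarrow> (nat \<Rightarrow> nat) \<Rightarrow> (nat \<Rightarrow> nat) set" where
  "factorizations k \<alpha> \<gamma> = {z \<in> nvec k. fact_hom k \<alpha> z = \<gamma>}"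

definition vlen :: "nat \<Rightarrow> (nat \<Rightarrow> nat) \<Rightarrow> nat" where
  "vlen k z = (\<Sum>i<k. z i)"

definition vgcd :: "(nat \<Rightarrow> nat) \<Rightarrow> (nat \<Rightarrow> nat) \<Rightarrow> (nat \<Rightarrow> nat)" where
  "vgcd z w = (\<lambda>i. min (z i) (w i))"

definition vdist :: "nat \<Rightarrow> (nat \<Rightarrow> nat) \<Rightarrow> (nat \<Rightarrow> nat) \<Rightarrow> nat" where
  "vdist k z w = max (vlen k (z - vgcd z w)) (vlen k (w - vgcd z w))"

definition unit_vec :: "nat \<Rightarrow> (nat \<Rightarrow> nat)" where
  "unit_vec i = (\<lambda>j. if j = i then 1 else 0)"

definition graver_basis :: "nat \<Rightarrow> (nat \<Rightarrow> nat \<Rightarrow> nat) \<Rightarrow> ((nat \<Rightarrow> nat) \<times> (nat \<Rightarrow> nat)) set" where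
  "graver_basis k \<alpha> = (THE B. minimal_generating_set B
     {(z, w). z \<in> nvec k \<and> w \<in> nvec k \<and> fact_hom k \<alpha> z = fact_hom k \<alpha> w})"

(* Simple undirected graphs; an edge is a two-element set of vertices. An edge labeling is given
   separately, as a symmetric function of the two endpoints, so that subgraphs inherit it. *)
record 'v ugraph =
  verts :: "'v set"
  edges :: "'v set set"

definition is_chain :: "'v ugraph \<Rightarrow> 'v \<Rightarrow> 'v list \<Rightarrow> 'v \<Rightarrow> bool" where
  "is_chain G u p v \<longleftrightarrow> p \<noteq> [] \<and> hd p = u \<and> last p = v \<and> set p \<subseteq> verts G \<and>
     successively (\<lambda>x y. {x, y} \<in> edges G) p"

definition is_path :: "'v ugraph \<Rightarrow> 'v \<Rightarrow> 'v list \<Rightarrow> 'v \<Rightarrow> bool" where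
  "is_path G u p v \<longleftrightarrow> is_chain G u p v \<and> distinct p"

definition connected_graph :: "'v ugraph \<Rightarrow> bool" where
  "connected_graph G \<longleftrightarrow> verts G \<noteq> {} \<and> (\<forall>u\<in>verts G. \<forall>v\<in>verts G. \<exists>p. is_chain G u p v)"

definition is_cycle :: "'v ugraph \<Rightarrow> 'v list \<Rightarrow> bool" where
  "is_cycle G p \<longleftrightarrow> 3 \<le> length p \<and> is_path G (hd p) p (last p) \<and> {last p, hd p} \<in> edges G"

definition spanning_tree :: "'v ugraph \<Rightarrow> 'v ugraph \<Rightarrow> bool" where
  "spanning_tree G T \<longleftrightarrow> verts T = verts G \<and> edges T \<subseteq> edges G \<and>
     connected_graph T \<and> (\<nexists>p. is_cycle T p)"

(* A one-vertex chain has no edges; its weight is 0. *)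
definition chain_weight :: "('v \<Rightarrow> 'v \<Rightarrow> nat) \<Rightarrow> 'v list \<Rightarrow> nat" where
  "chain_weight l p = Max (insert 0 {l (p ! i) (p ! Suc i) | i. Suc i < length p})"

definition min_weight_spanning_tree ::
    "('v \<Rightarrow> 'v \<Rightarrow> nat) \<Rightarrow> 'v ugraph \<Rightarrow> 'v ugraph \<Rightarrow> bool" where
  "min_weight_spanning_tree l G T \<longleftrightarrow> spanning_tree G T \<and>
     (\<forall>u\<in>verts G. \<forall>v\<in>verts G. \<forall>p c. is_path T u p v \<longrightarrow> is_chain G u c v \<longrightarrow>
        chain_weight l p \<le> chain_weight l c)"

definition graph_image :: "('v \<Rightarrow> 'w) \<Rightarrow> 'v ugraph \<Rightarrow> 'w ugraph" where
  "graph_image f G = \<lparr>verts = f ` verts G, edges = (\<lambda>e. f ` e) ` edges G\<rparr>"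

definition catenary_graph ::
    "nat \<Rightarrow> (nat \<Rightarrow> nat \<Rightarrow> nat) \<Rightarrow> (nat \<Rightarrow> nat) \<Rightarrow> (nat \<Rightarrow> nat) ugraph" where
  "catenary_graph k \<alpha> \<gamma> = \<lparr>verts = factorizations k \<alpha> \<gamma>,
     edges = {{z, w} | z w. z \<in> factorizations k \<alpha> \<gamma> \<and> w \<in> factorizations k \<alpha> \<gamma> \<and> z \<noteq> w}\<rparr>"

definition cover_morphism :: "nat \<Rightarrow> (nat \<Rightarrow> nat) \<Rightarrow> (nat \<Rightarrow> nat)" where
  "cover_morphism i z = z + unit_vec i"

(* gamma - delta in M, the difference being taken in Z^d: subtraction on nat truncates. *)
definition diff_in :: "(nat \<Rightarrow> nat) \<Rightarrow> (nat \<Rightarrow> nat) \<Rightarrow> (nat \<Rightarrow> nat) set \<Rightarrow> bool" where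
  "diff_in \<gamma> \<delta> M \<longleftrightarrow> \<delta> \<le> \<gamma> \<and> \<gamma> - \<delta> \<in> M"

(* The Graver basis also contains the pairs (e_i, e_i); these are not edges of the catenary graph,
   whence the condition z \<noteq> w. *)
definition graver_edges ::
    "nat \<Rightarrow> (nat \<Rightarrow> nat \<Rightarrow> nat) \<Rightarrow> (nat \<Rightarrow> nat) \<Rightarrow> (nat \<Rightarrow> nat) set set" where
  "graver_edges k \<alpha> \<gamma> = {{z, w} | z w. (z, w) \<in> graver_basis k \<alpha> \<and>
     z \<in> factorizations k \<alpha> \<gamma> \<and> w \<in> factorizations k \<alpha> \<gamma> \<and> z \<noteq> w}"

end

theory Submission
  imports Defs "HOL-Library.Transitive_Closure_Table"
begin

text \<open>
  It suffices to join the ends of every edge \<open>{z, w}\<close> of the catenary graph by a chain of \<open>G'\<close> of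
  weight at most \<open>dist(z, w)\<close>: every chain of the catenary graph can then be replaced by one of
  \<open>G'\<close> whose weight is no larger. If \<open>z\<close> and \<open>w\<close> share the generator \<open>i\<close>, the path of \<open>T\<^sub>i\<close> does
  this, as translation preserves distances. If they are disjoint and \<open>(z, w)\<close> is not in the Graver
  basis, write \<open>(z, w) = (z\<^sub>1, w\<^sub>1) + (z\<^sub>2, w\<^sub>2)\<close> with both pairs nonzero. Generators are nonzero, so
  all four vectors are nonzero, and the steps of \<open>z, w\<^sub>1 + z\<^sub>2, w\<close> are both of the first kind and
  no longer than \<open>max(|z|, |w|) = dist(z, w)\<close>.
\<close>

section \<open>Minimal generating sets of monoids\<close>

lemma add_submonoid_hull: "add_submonoid (add_submonoid hull A)"
  by (rule hull_in) (auto simp: add_submonoid_def)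

lemma add_submonoid_zero: "add_submonoid M \<Longrightarrow> 0 \<in> M"
  by (simp add: add_submonoid_def)

lemma add_submonoid_add: "add_submonoid M \<Longrightarrow> x \<in> M \<Longrightarrow> y \<in> M \<Longrightarrow> x + y \<in> M"
  by (simp add: add_submonoid_def)

lemma add_submonoid_sum:
  assumes "add_submonoid M" "\<And>i. i \<in> I \<Longrightarrow> f i \<in> M"
  shows "sum f I \<in> M"
  using assms(2)
  by (induction I rule: infinite_finite_induct)
    (auto intro: add_submonoid_zero[OF assms(1)] add_submonoid_add[OF assms(1)])

lemma zero_notin_minimal_generating_set:
  assumes "minimal_generating_set B M"
  shows "0 \<notin> B"
proof
  assume "0 \<in> B"
  have "0 \<in> add_submonoid hull (B - {0})"
    by (intro add_submonoid_zero add_submonoid_hull)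
  then have "add_submonoid hull (B - {0}) = add_submonoid hull B"
    using hull_redundant insert_Diff[OF \<open>0 \<in> B\<close>] by metis
  moreover have "B - {0} \<subset> B" using \<open>0 \<in> B\<close> by blast
  ultimately show False using assms by (auto simp: minimal_generating_set_def)
qed

definition monoid_atoms :: "'a::comm_monoid_add set \<Rightarrow> 'a set" where
  "monoid_atoms M = {x \<in> M. x \<noteq> 0 \<and> (\<forall>y\<in>M. \<forall>z\<in>M. x = y + z \<longrightarrow> y = 0 \<or> z = 0)}"

lemma add_submonoid_remove_atom:
  assumes "add_submonoid M" "a \<in> monoid_atoms M"
  shows "add_submonoid (M - {a})"
  unfolding add_submonoid_def
proof (intro conjI ballI)
  show "0 \<in> M - {a}" using assms by (auto simp: add_submonoid_def monoid_atoms_def)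
next
  fix x y assume xy: "x \<in> M - {a}" "y \<in> M - {a}"
  have "x + y \<noteq> a"
  proof
    assume "x + y = a"
    then have "x = 0 \<or> y = 0" using assms(2) xy by (auto simp: monoid_atoms_def)
    then show False using \<open>x + y = a\<close> xy by auto
  qed
  then show "x + y \<in> M - {a}" using assms(1) xy by (auto simp: add_submonoid_def)
qed

lemma monoid_atoms_subset_generating:
  assumes "add_submonoid hull B = M"
  shows "monoid_atoms M \<subseteq> B"
proof (rule subsetI, rule ccontr)
  fix a assume a: "a \<in> monoid_atoms M" "a \<notin> B"
  have "add_submonoid M" using add_submonoid_hull assms by metis
  then have "add_submonoid hull B \<subseteq> M - {a}"
    using a hull_subset[of B add_submonoid] assms
    by (intro hull_minimal add_submonoid_remove_atom) auto
  then show False using a assms by (auto simp: monoid_atoms_def)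
qed

lemma hull_monoid_atoms:
  fixes size :: "'a::comm_monoid_add \<Rightarrow> nat"
  assumes M: "add_submonoid M"
    and size: "\<And>x y. x \<in> M \<Longrightarrow> y \<in> M \<Longrightarrow> y \<noteq> 0 \<Longrightarrow> size x < size (x + y)"
  shows "add_submonoid hull (monoid_atoms M) = M"
proof
  let ?H = "add_submonoid hull (monoid_atoms M)"
  show "?H \<subseteq> M"
    using M by (intro hull_minimal) (auto simp: monoid_atoms_def)
  have "x \<in> ?H" if "x \<in> M" for x
    using that
  proof (induction "size x" arbitrary: x rule: less_induct)
    case less
    consider (zero) "x = 0" | (atom) "x \<in> monoid_atoms M"
      | (sum) y z where "y \<in> M" "z \<in> M" "x = y + z" "y \<noteq> 0" "z \<noteq> 0"
      using less.prems unfolding monoid_atoms_def by blast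
    then show ?case
    proof cases
      case zero
      then show ?thesis by (simp add: add_submonoid_zero add_submonoid_hull)
    next
      case atom
      then show ?thesis by (rule hull_inc)
    next
      case sum
      then have "y \<in> ?H" "z \<in> ?H"
        using less.hyps size[of y z] size[of z y] by (auto simp: add.commute)
      then show ?thesis using sum by (simp add: add_submonoid_add add_submonoid_hull)
    qed
  qed
  then show "M \<subseteq> ?H" by blast
qed

lemma minimal_generating_set_iff_monoid_atoms:
  fixes size :: "'a::comm_monoid_add \<Rightarrow> nat"
  assumes "add_submonoid M"
    and "\<And>x y. x \<in> M \<Longrightarrow> y \<in> M \<Longrightarrow> y \<noteq> 0 \<Longrightarrow> size x < size (x + y)"
  shows "minimal_generating_set B M \<longleftrightarrow> B = monoid_atoms M"
proof -
  have hull: "add_submonoid hull monoid_atoms M = M" using assms by (rule hull_monoid_atoms)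
  show ?thesis
  proof
    assume B: "minimal_generating_set B M"
    then have "monoid_atoms M \<subseteq> B"
      by (intro monoid_atoms_subset_generating) (simp add: minimal_generating_set_def)
    moreover have "\<not> monoid_atoms M \<subset> B"
      using B hull by (auto simp: minimal_generating_set_def)
    ultimately show "B = monoid_atoms M" by blast
  next
    assume B: "B = monoid_atoms M"
    have "add_submonoid hull A \<noteq> M" if "A \<subset> B" for A
      using monoid_atoms_subset_generating[of A M] that B by auto
    then show "minimal_generating_set B M" using hull B by (simp add: minimal_generating_set_def)
  qed
qed

section \<open>Factorizations and the Graver basis\<close>

lemma nvec_zero [simp]: "0 \<in> nvec k"
  by (simp add: nvec_def)

lemma nvec_add_iff [simp]: "z + w \<in> nvec k \<longleftrightarrow> z \<in> nvec k \<and> w \<in> nvec k"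
  by (auto simp: nvec_def)

lemma unit_vec_nvec: "i < k \<Longrightarrow> unit_vec i \<in> nvec k"
  by (auto simp: unit_vec_def nvec_def)

lemma vlen_add: "vlen k (z + w) = vlen k z + vlen k w"
  by (simp add: vlen_def sum.distrib)

lemma vlen_eq_zero_iff: "z \<in> nvec k \<Longrightarrow> vlen k z = 0 \<longleftrightarrow> z = 0"
  by (auto simp: vlen_def nvec_def fun_eq_iff) (metis lessThan_iff not_le)

lemma vgcd_eq_zero_iff: "vgcd z w = 0 \<longleftrightarrow> (\<forall>i. z i = 0 \<or> w i = 0)"
  by (auto simp: vgcd_def fun_eq_iff min_def) (metis not_gr_zero zero_le)+

lemma vdist_add: "vdist k (u + z) (u + w) = vdist k z w"
proof -
  have "u + z - vgcd (u + z) (u + w) = z - vgcd z w" "u + w - vgcd (u + z) (u + w) = w - vgcd z w"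
    by (auto simp: vgcd_def fun_eq_iff)
  then show ?thesis by (simp add: vdist_def)
qed

lemma vdist_le: "vdist k z w \<le> max (vlen k z) (vlen k w)"
  unfolding vdist_def vlen_def by (intro max.mono sum_mono) auto

lemma vdist_disjoint: "vgcd z w = 0 \<Longrightarrow> vdist k z w = max (vlen k z) (vlen k w)"
  by (simp add: vdist_def)

lemma vdist_cover_morphism: "vdist k (cover_morphism i z) (cover_morphism i w) = vdist k z w"
  by (simp add: cover_morphism_def add.commute[of _ "unit_vec i"] vdist_add)

lemma fact_hom_add: "fact_hom k \<alpha> (z + w) = fact_hom k \<alpha> z + fact_hom k \<alpha> w"
  by (auto simp: fact_hom_def fun_eq_iff sum.distrib algebra_simps)

lemma fact_hom_zero [simp]: "fact_hom k \<alpha> 0 = 0"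
  by (auto simp: fact_hom_def fun_eq_iff)

lemma fact_hom_unit_vec: "i < k \<Longrightarrow> fact_hom k \<alpha> (unit_vec i) = \<alpha> i"
  by (auto simp: fact_hom_def unit_vec_def fun_eq_iff if_distrib[of "\<lambda>x. x * _"] cong: if_cong)

lemma fact_hom_eq_zero_iff:
  assumes "0 \<notin> \<alpha> ` {..<k}" "z \<in> nvec k"
  shows "fact_hom k \<alpha> z = 0 \<longleftrightarrow> z = 0"
proof
  assume hom: "fact_hom k \<alpha> z = 0"
  have "z i = 0" if "i < k" for i
  proof -
    have "\<alpha> i \<noteq> 0" using assms(1) that by (metis imageI lessThan_iff)
    then obtain j where j: "\<alpha> i j \<noteq> 0" by (auto simp: fun_eq_iff)
    have "(\<Sum>i<k. z i * \<alpha> i j) = 0" using fun_cong[OF hom, of j] by (simp add: fact_hom_def)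
    then show ?thesis using that j by auto
  qed
  moreover have "z i = 0" if "k \<le> i" for i using assms(2) that by (simp add: nvec_def)
  ultimately show "z = 0" by (metis ext not_le zero_fun_apply)
qed simp

lemma sum_fun_apply: "(\<Sum>i\<in>I. f i) x = (\<Sum>i\<in>I. f i x)"
  by (induction I rule: infinite_finite_induct) auto

lemma hull_generators_eq_fact_hom_image:
  "add_submonoid hull (\<alpha> ` {..<k}) = fact_hom k \<alpha> ` nvec k"
proof
  have "add_submonoid (fact_hom k \<alpha> ` nvec k)"
    unfolding add_submonoid_def
    by (auto simp: fact_hom_add[symmetric] intro!: image_eqI[of _ _ "0::nat \<Rightarrow> nat"])
  moreover have "\<alpha> ` {..<k} \<subseteq> fact_hom k \<alpha> ` nvec k"
    by (metis fact_hom_unit_vec unit_vec_nvec image_eqI image_subsetI lessThan_iff)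
  ultimately show "add_submonoid hull (\<alpha> ` {..<k}) \<subseteq> fact_hom k \<alpha> ` nvec k"
    by (rule hull_minimal[rotated])
next
  have "fact_hom k \<alpha> z = (\<Sum>i<k. \<Sum>_<z i. \<alpha> i)" for z
    by (simp add: fact_hom_def fun_eq_iff sum_fun_apply)
  moreover have "(\<Sum>i<k. \<Sum>_<z i. \<alpha> i) \<in> add_submonoid hull (\<alpha> ` {..<k})" for z :: "nat \<Rightarrow> nat"
    by (rule add_submonoid_sum[OF add_submonoid_hull],
        rule add_submonoid_sum[OF add_submonoid_hull]) (simp add: hull_inc)
  ultimately show "fact_hom k \<alpha> ` nvec k \<subseteq> add_submonoid hull (\<alpha> ` {..<k})" by auto
qed

definition fact_kernel ::
    "nat \<Rightarrow> (nat \<Rightarrow> nat \<Rightarrow> nat) \<Rightarrow> ((nat \<Rightarrow> nat) \<times> (nat \<Rightarrow> nat)) set" where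
  "fact_kernel k \<alpha> = {(z, w). z \<in> nvec k \<and> w \<in> nvec k \<and> fact_hom k \<alpha> z = fact_hom k \<alpha> w}"

lemma graver_basis_eq_monoid_atoms: "graver_basis k \<alpha> = monoid_atoms (fact_kernel k \<alpha>)"
proof -
  let ?size = "\<lambda>(z, w). vlen k z + vlen k w"
  have "add_submonoid (fact_kernel k \<alpha>)"
    by (auto simp: add_submonoid_def fact_kernel_def zero_prod_def fact_hom_add)
  moreover have "?size x < ?size (x + y)" if "y \<in> fact_kernel k \<alpha>" "y \<noteq> 0" for x y
    using that
    by (auto simp: fact_kernel_def zero_prod_def vlen_add vlen_eq_zero_iff split: prod.splits)
  ultimately have "minimal_generating_set B (fact_kernel k \<alpha>) \<longleftrightarrow>
      B = monoid_atoms (fact_kernel k \<alpha>)" for B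
    by (intro minimal_generating_set_iff_monoid_atoms[where size = ?size])
  then show ?thesis unfolding graver_basis_def fact_kernel_def by simp
qed

lemma graver_basis_decompositionE:
  assumes "0 \<notin> \<alpha> ` {..<k}"
    and "(z, w) \<in> fact_kernel k \<alpha>" "(z, w) \<noteq> 0" "(z, w) \<notin> graver_basis k \<alpha>"
  obtains z\<^sub>1 w\<^sub>1 z\<^sub>2 w\<^sub>2 where "z = z\<^sub>1 + z\<^sub>2" "w = w\<^sub>1 + w\<^sub>2"
    and "(z\<^sub>1, w\<^sub>1) \<in> fact_kernel k \<alpha>" "(z\<^sub>2, w\<^sub>2) \<in> fact_kernel k \<alpha>" "w\<^sub>1 \<noteq> 0" "z\<^sub>2 \<noteq> 0"
proof -
  obtain p q where pq: "p \<in> fact_kernel k \<alpha>" "q \<in> fact_kernel k \<alpha>" "(z, w) = p + q" "p \<noteq> 0" "q \<noteq> 0"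
    using assms(2-4) unfolding graver_basis_eq_monoid_atoms monoid_atoms_def by blast
  obtain z\<^sub>1 w\<^sub>1 z\<^sub>2 w\<^sub>2 where eq: "p = (z\<^sub>1, w\<^sub>1)" "q = (z\<^sub>2, w\<^sub>2)" by fastforce
  have zero_iff: "x = 0 \<longleftrightarrow> y = 0" if "(x, y) \<in> fact_kernel k \<alpha>" for x y
    using that fact_hom_eq_zero_iff[OF assms(1)] by (auto simp: fact_kernel_def)
  show thesis
    by (rule that[of z\<^sub>1 z\<^sub>2 w\<^sub>1 w\<^sub>2]) (use pq eq zero_iff in \<open>auto simp: zero_prod_def\<close>)
qed

lemma disjoint_factorizations_intermediate:
  assumes "0 \<notin> \<alpha> ` {..<k}" "z \<in> factorizations k \<alpha> \<gamma>" "w \<in> factorizations k \<alpha> \<gamma>"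
    and "z \<noteq> w" "vgcd z w = 0" "(z, w) \<notin> graver_basis k \<alpha>"
  obtains u where "u \<in> factorizations k \<alpha> \<gamma>" "vgcd z u \<noteq> 0" "vgcd u w \<noteq> 0"
    and "vdist k z u \<le> vdist k z w" "vdist k u w \<le> vdist k z w"
proof -
  have "(z, w) \<in> fact_kernel k \<alpha>" "(z, w) \<noteq> 0"
    using assms(2-4) by (auto simp: factorizations_def fact_kernel_def zero_prod_def)
  then obtain z\<^sub>1 w\<^sub>1 z\<^sub>2 w\<^sub>2 where z: "z = z\<^sub>1 + z\<^sub>2" and w: "w = w\<^sub>1 + w\<^sub>2"
    and kernel: "(z\<^sub>1, w\<^sub>1) \<in> fact_kernel k \<alpha>" "(z\<^sub>2, w\<^sub>2) \<in> fact_kernel k \<alpha>"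
    and nonzero: "w\<^sub>1 \<noteq> 0" "z\<^sub>2 \<noteq> 0"
    using assms(6) by (rule graver_basis_decompositionE[OF assms(1)])
  let ?u = "w\<^sub>1 + z\<^sub>2"
  have dist: "vdist k z w = max (vlen k z\<^sub>1 + vlen k z\<^sub>2) (vlen k w\<^sub>1 + vlen k w\<^sub>2)"
    using assms(5) by (simp add: vdist_disjoint z w vlen_add)
  show thesis
  proof (rule that)
    show "?u \<in> factorizations k \<alpha> \<gamma>"
      using assms(2) kernel by (auto simp: z factorizations_def fact_kernel_def fact_hom_add)
    show "vgcd z ?u \<noteq> 0" "vgcd ?u w \<noteq> 0"
      using nonzero unfolding vgcd_eq_zero_iff z w by (auto simp: fun_eq_iff)
    have "vdist k z ?u = vdist k z\<^sub>1 w\<^sub>1"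
      using vdist_add[of k z\<^sub>2 z\<^sub>1 w\<^sub>1] by (simp add: z add.commute)
    then show "vdist k z ?u \<le> vdist k z w" using vdist_le[of k z\<^sub>1 w\<^sub>1] dist by simp
    have "vdist k ?u w = vdist k z\<^sub>2 w\<^sub>2" by (simp add: w vdist_add)
    then show "vdist k ?u w \<le> vdist k z w" using vdist_le[of k z\<^sub>2 w\<^sub>2] dist by simp
  qed
qed

section \<open>Bottleneck subgraphs\<close>

definition subgraph :: "'v ugraph \<Rightarrow> 'v ugraph \<Rightarrow> bool" where
  "subgraph G H \<longleftrightarrow> verts G \<subseteq> verts H \<and> edges G \<subseteq> edges H"

lemma subgraph_refl: "subgraph G G"
  by (simp add: subgraph_def)

lemma subgraph_trans: "subgraph F G \<Longrightarrow> subgraph G H \<Longrightarrow> subgraph F H"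
  by (auto simp: subgraph_def)

lemma subgraph_graph_image: "subgraph G H \<Longrightarrow> subgraph (graph_image f G) (graph_image f H)"
  by (auto simp: subgraph_def graph_image_def)

definition light_adjacent :: "('v \<Rightarrow> 'v \<Rightarrow> nat) \<Rightarrow> 'v ugraph \<Rightarrow> nat \<Rightarrow> 'v \<Rightarrow> 'v \<Rightarrow> bool" where
  "light_adjacent l G W x y \<longleftrightarrow> x \<in> verts G \<and> y \<in> verts G \<and> {x, y} \<in> edges G \<and> l x y \<le> W"

abbreviation light_reachable :: "('v \<Rightarrow> 'v \<Rightarrow> nat) \<Rightarrow> 'v ugraph \<Rightarrow> nat \<Rightarrow> 'v \<Rightarrow> 'v \<Rightarrow> bool" where
  "light_reachable l G W \<equiv> (light_adjacent l G W)\<^sup>*\<^sup>*"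

lemma chain_weight_le_iff: "chain_weight l p \<le> W \<longleftrightarrow> successively (\<lambda>x y. l x y \<le> W) p"
proof -
  have "finite {l (p ! i) (p ! Suc i) | i. Suc i < length p}"
    by (rule finite_subset[of _ "(\<lambda>i. l (p ! i) (p ! Suc i)) ` {..<length p}"]) auto
  then show ?thesis
    unfolding chain_weight_def successively_conv_nth by (subst Max_le_iff) auto
qed

lemma rtrancl_path_iff_successively:
  "rtrancl_path R x xs y \<longleftrightarrow> successively R (x # xs) \<and> last (x # xs) = y"
  by (induction xs arbitrary: x)
    (auto simp: rtrancl_path.simps[of R _ "[]"] rtrancl_path.simps[of R _ "_ # _"])

lemma rtrancl_path_light_adjacent_iff:
  assumes "u \<in> verts G"
  shows "rtrancl_path (light_adjacent l G W) u xs v \<longleftrightarrow>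
    is_chain G u (u # xs) v \<and> chain_weight l (u # xs) \<le> W"
proof -
  have "successively (light_adjacent l G W) (u # xs) \<longleftrightarrow>
      set xs \<subseteq> verts G \<and> successively (\<lambda>x y. {x, y} \<in> edges G) (u # xs) \<and>
      successively (\<lambda>x y. l x y \<le> W) (u # xs)"
    using assms by (induction xs arbitrary: u) (auto simp: light_adjacent_def)
  then show ?thesis
    using assms by (auto simp: rtrancl_path_iff_successively is_chain_def chain_weight_le_iff)
qed

lemma is_chain_imp_light_reachable:
  assumes "is_chain G u p v" "chain_weight l p \<le> W"
  shows "light_reachable l G W u v"
proof -
  obtain xs where "p = u # xs" "u \<in> verts G"
    using assms(1) by (cases p) (auto simp: is_chain_def)
  then show ?thesis
    using assms unfolding rtranclp_eq_rtrancl_path by (auto simp: rtrancl_path_light_adjacent_iff)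
qed

lemma light_reachable_imp_is_path:
  assumes "light_reachable l G W u v" "u \<in> verts G"
  obtains p where "is_path G u p v" "chain_weight l p \<le> W"
proof -
  obtain xs where "rtrancl_path (light_adjacent l G W) u xs v" "distinct (u # xs)"
    using assms(1) unfolding rtranclp_eq_rtrancl_path by (metis rtrancl_path_distinct)
  then show thesis
    using assms(2) that[of "u # xs"] by (simp add: rtrancl_path_light_adjacent_iff is_path_def)
qed

lemma connected_graph_iff_light_reachable:
  "connected_graph G \<longleftrightarrow>
    verts G \<noteq> {} \<and> (\<forall>u\<in>verts G. \<forall>v\<in>verts G. \<exists>W. light_reachable l G W u v)"
proof -
  have "(\<exists>p. is_chain G u p v) \<longleftrightarrow> (\<exists>W. light_reachable l G W u v)" if "u \<in> verts G" for u v
    using that is_chain_imp_light_reachable light_reachable_imp_is_path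
    unfolding is_path_def by (metis order_refl)
  then show ?thesis by (simp add: connected_graph_def)
qed

lemma connected_graph_imp_is_path:
  assumes "connected_graph G" "u \<in> verts G" "v \<in> verts G"
  obtains p where "is_path G u p v"
proof -
  obtain W where "light_reachable (\<lambda>_ _. 0) G W u v"
    using assms by (auto simp: connected_graph_iff_light_reachable[where l = "\<lambda>_ _. 0"])
  then show thesis using assms(2) that by (rule light_reachable_imp_is_path)
qed

lemma light_reachable_mono:
  assumes "light_reachable l G W u v" "subgraph G H" "W \<le> W'"
  shows "light_reachable l H W' u v"
proof -
  have "light_adjacent l G W \<le> light_adjacent l H W'"
    using assms(2,3) by (auto simp: light_adjacent_def subgraph_def)
  then show ?thesis using assms(1) by (metis rtranclp_mono predicate2D)
qed

lemma light_reachable_graph_image: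
  assumes "light_reachable l G W u v"
    and "\<And>x y. {x, y} \<in> edges G \<Longrightarrow> l' (f x) (f y) \<le> l x y"
  shows "light_reachable l' (graph_image f G) W (f u) (f v)"
  using assms(1)
proof (induction rule: rtranclp_induct)
  case (step x y)
  have "f ` {x, y} \<in> edges (graph_image f G)"
    using step.hyps(2) by (simp add: light_adjacent_def graph_image_def del: image_insert)
  moreover have "l' (f x) (f y) \<le> W"
    using step.hyps(2) assms(2)[of x y] by (auto simp: light_adjacent_def)
  ultimately have "light_adjacent l' (graph_image f G) W (f x) (f y)"
    using step.hyps(2) by (simp add: light_adjacent_def graph_image_def)
  with step.IH show ?case by (rule rtranclp.rtrancl_into_rtrancl)
qed simp

definition bottleneck_subgraph :: "('v \<Rightarrow> 'v \<Rightarrow> nat) \<Rightarrow> 'v ugraph \<Rightarrow> 'v ugraph \<Rightarrow> bool" where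
  "bottleneck_subgraph l G K \<longleftrightarrow> verts G = verts K \<and> edges G \<subseteq> edges K \<and>
     (\<forall>W u v. light_reachable l K W u v \<longrightarrow> light_reachable l G W u v)"

lemma bottleneck_subgraphD:
  assumes "bottleneck_subgraph l G K"
  shows "verts G = verts K" "edges G \<subseteq> edges K"
    and "light_reachable l K W u v \<Longrightarrow> light_reachable l G W u v"
  using assms unfolding bottleneck_subgraph_def by blast+

lemma bottleneck_subgraphI:
  assumes "verts G = verts K" "edges G \<subseteq> edges K"
    and edge: "\<And>x y. x \<in> verts K \<Longrightarrow> y \<in> verts K \<Longrightarrow> {x, y} \<in> edges K \<Longrightarrow>
      light_reachable l G (l x y) x y"
  shows "bottleneck_subgraph l G K"
proof -
  have "light_adjacent l K W \<le> light_reachable l G W" for W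
  proof (rule predicate2I)
    fix x y assume "light_adjacent l K W x y"
    then have "light_reachable l G (l x y) x y" "l x y \<le> W"
      using edge by (simp_all add: light_adjacent_def)
    then show "light_reachable l G W x y" by (rule light_reachable_mono[OF _ subgraph_refl])
  qed
  then have "light_reachable l K W \<le> light_reachable l G W" for W
    using rtranclp_mono rtranclp_idemp by metis
  then show ?thesis using assms(1,2) unfolding bottleneck_subgraph_def by blast
qed

lemma connected_graph_if_bottleneck_subgraph:
  assumes "bottleneck_subgraph l G K" "connected_graph K"
  shows "connected_graph G"
  using assms(2) bottleneck_subgraphD[OF assms(1)]
  unfolding connected_graph_iff_light_reachable[where l = l] by metis

lemma min_weight_spanning_tree_imp_bottleneck_subgraph:
  assumes "min_weight_spanning_tree l K T"
  shows "bottleneck_subgraph l T K"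
proof (rule bottleneck_subgraphI)
  show verts: "verts T = verts K" and "edges T \<subseteq> edges K"
    using assms by (auto simp: min_weight_spanning_tree_def spanning_tree_def)
  fix x y assume xy: "x \<in> verts K" "y \<in> verts K" "{x, y} \<in> edges K"
  have "connected_graph T"
    using assms by (simp add: min_weight_spanning_tree_def spanning_tree_def)
  then obtain p where p: "is_path T x p y"
    using xy(1,2) unfolding verts[symmetric] by (rule connected_graph_imp_is_path)
  have "is_chain K x [x, y] y" using xy by (simp add: is_chain_def)
  then have "chain_weight l p \<le> chain_weight l [x, y]"
    using assms xy p unfolding min_weight_spanning_tree_def by blast
  also have "\<dots> \<le> l x y" by (simp add: chain_weight_le_iff)
  finally show "light_reachable l T (l x y) x y"
    using p by (intro is_chain_imp_light_reachable) (simp_all add: is_path_def)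
qed

lemma min_weight_spanning_tree_if_bottleneck_subgraph:
  assumes G: "bottleneck_subgraph l G K" and S: "min_weight_spanning_tree l G S"
  shows "min_weight_spanning_tree l K S"
  unfolding min_weight_spanning_tree_def
proof (intro conjI ballI allI impI)
  note verts = bottleneck_subgraphD(1)[OF G]
  show "spanning_tree K S"
    using S bottleneck_subgraphD(2)[OF G]
    by (auto simp: min_weight_spanning_tree_def spanning_tree_def verts)
  fix u v p c
  assume uv: "u \<in> verts K" "v \<in> verts K" and p: "is_path S u p v" and c: "is_chain K u c v"
  have "light_reachable l K (chain_weight l c) u v"
    using c by (rule is_chain_imp_light_reachable) simp
  then have "light_reachable l G (chain_weight l c) u v"
    by (rule bottleneck_subgraphD(3)[OF G])
  then obtain c' where c': "is_path G u c' v" "chain_weight l c' \<le> chain_weight l c"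
    using uv(1) unfolding verts[symmetric] by (rule light_reachable_imp_is_path)
  have "chain_weight l p \<le> chain_weight l c'"
    using S uv p c'(1) verts by (simp add: min_weight_spanning_tree_def is_path_def)
  then show "chain_weight l p \<le> chain_weight l c" using c'(2) by simp
qed

section \<open>Catenary graphs and cover morphisms\<close>

lemma verts_catenary_graph [simp]: "verts (catenary_graph k \<alpha> \<gamma>) = factorizations k \<alpha> \<gamma>"
  by (simp add: catenary_graph_def)

lemma doubleton_in_edges_catenary_graph_iff:
  "{z, w} \<in> edges (catenary_graph k \<alpha> \<gamma>) \<longleftrightarrow>
    z \<in> factorizations k \<alpha> \<gamma> \<and> w \<in> factorizations k \<alpha> \<gamma> \<and> z \<noteq> w"
  by (auto simp: catenary_graph_def doubleton_eq_iff)

lemma light_reachable_catenary_graph: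
  assumes "z \<in> factorizations k \<alpha> \<gamma>" "w \<in> factorizations k \<alpha> \<gamma>"
  shows "light_reachable l (catenary_graph k \<alpha> \<gamma>) (l z w) z w"
proof (cases "z = w")
  case False
  then have "light_adjacent l (catenary_graph k \<alpha> \<gamma>) (l z w) z w"
    using assms by (simp add: light_adjacent_def doubleton_in_edges_catenary_graph_iff)
  then show ?thesis by (intro r_into_rtranclp)
qed simp

lemma connected_catenary_graph:
  assumes "factorizations k \<alpha> \<gamma> \<noteq> {}"
  shows "connected_graph (catenary_graph k \<alpha> \<gamma>)"
  unfolding connected_graph_iff_light_reachable[where l = "vdist k"] verts_catenary_graph
  using assms light_reachable_catenary_graph by blast

lemma graver_edges_subset_catenary_graph: "graver_edges k \<alpha> \<gamma> \<subseteq> edges (catenary_graph k \<alpha> \<gamma>)"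
  by (auto simp: graver_edges_def catenary_graph_def)

lemma factorization_cover_morphismE:
  assumes "z \<in> factorizations k \<alpha> \<gamma>" "z i > 0"
  obtains z' where "i < k" "\<alpha> i \<le> \<gamma>" "z' \<in> factorizations k \<alpha> (\<gamma> - \<alpha> i)" "z = cover_morphism i z'"
proof -
  have i: "i < k" using assms by (auto simp: factorizations_def nvec_def intro: ccontr)
  have z: "z = cover_morphism i (z - unit_vec i)"
    using assms(2) by (auto simp: cover_morphism_def unit_vec_def fun_eq_iff)
  have "\<gamma> = fact_hom k \<alpha> (z - unit_vec i) + \<alpha> i" "z - unit_vec i \<in> nvec k"
    using assms(1) i fact_hom_add[of k \<alpha> "z - unit_vec i" "unit_vec i"] z[symmetric]
    by (auto simp: factorizations_def cover_morphism_def fact_hom_unit_vec nvec_def)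
  then have "\<alpha> i \<le> \<gamma>" "z - unit_vec i \<in> factorizations k \<alpha> (\<gamma> - \<alpha> i)"
    by (auto simp: factorizations_def le_fun_def fun_eq_iff)
  then show thesis using i z by (intro that)
qed

lemma positive_coordinate_imp_diff_in:
  assumes "z \<in> factorizations k \<alpha> \<gamma>" "z i > 0"
  shows "i < k" "diff_in \<gamma> (\<alpha> i) (fact_hom k \<alpha> ` nvec k)"
proof -
  obtain z' where z': "i < k" "\<alpha> i \<le> \<gamma>" "z' \<in> factorizations k \<alpha> (\<gamma> - \<alpha> i)"
    using assms by (rule factorization_cover_morphismE)
  then show "i < k" "diff_in \<gamma> (\<alpha> i) (fact_hom k \<alpha> ` nvec k)"
    by (auto simp: diff_in_def factorizations_def intro!: image_eqI[of _ _ z'])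
qed

lemma cover_morphism_factorization:
  assumes "i < k" "\<alpha> i \<le> \<gamma>" "z \<in> factorizations k \<alpha> (\<gamma> - \<alpha> i)"
  shows "cover_morphism i z \<in> factorizations k \<alpha> \<gamma>"
  using assms unit_vec_nvec
  by (auto simp: cover_morphism_def factorizations_def fact_hom_add fact_hom_unit_vec le_fun_def
      fun_eq_iff)

lemma subgraph_cover_morphism_image:
  assumes "i < k" "\<alpha> i \<le> \<gamma>"
  shows "subgraph (graph_image (cover_morphism i) (catenary_graph k \<alpha> (\<gamma> - \<alpha> i)))
    (catenary_graph k \<alpha> \<gamma>)"
  unfolding subgraph_def
proof (intro conjI subsetI)
  let ?I = "graph_image (cover_morphism i) (catenary_graph k \<alpha> (\<gamma> - \<alpha> i))"
  note factorization = cover_morphism_factorization[of i k \<alpha>, OF assms]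
  show "v \<in> verts (catenary_graph k \<alpha> \<gamma>)" if "v \<in> verts ?I" for v
    using that by (auto simp: graph_image_def factorization)
  show "e \<in> edges (catenary_graph k \<alpha> \<gamma>)" if "e \<in> edges ?I" for e
  proof -
    obtain z w where "e = {cover_morphism i z, cover_morphism i w}" "z \<noteq> w"
      "z \<in> factorizations k \<alpha> (\<gamma> - \<alpha> i)" "w \<in> factorizations k \<alpha> (\<gamma> - \<alpha> i)"
      using \<open>e \<in> edges ?I\<close> by (auto simp: graph_image_def catenary_graph_def)
    moreover from this have "cover_morphism i z \<noteq> cover_morphism i w"
      by (simp add: cover_morphism_def)
    ultimately show ?thesis
      by (simp add: doubleton_in_edges_catenary_graph_iff factorization)
  qed
qed

lemma subgraph_cover_tree:
  assumes "i < k" "\<alpha> i \<le> \<gamma>" "spanning_tree (catenary_graph k \<alpha> (\<gamma> - \<alpha> i)) S"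
  shows "subgraph (graph_image (cover_morphism i) S) (catenary_graph k \<alpha> \<gamma>)"
proof (rule subgraph_trans)
  show "subgraph (graph_image (cover_morphism i) S)
      (graph_image (cover_morphism i) (catenary_graph k \<alpha> (\<gamma> - \<alpha> i)))"
    using assms(3) by (intro subgraph_graph_image) (simp add: subgraph_def spanning_tree_def)
qed (rule subgraph_cover_morphism_image[of i k \<alpha>, OF assms(1,2)])

lemma light_reachable_cover_tree:
  assumes "min_weight_spanning_tree (vdist k) (catenary_graph k \<alpha> (\<gamma> - \<alpha> i)) S"
    and "z \<in> factorizations k \<alpha> \<gamma>" "z i > 0" "w \<in> factorizations k \<alpha> \<gamma>" "w i > 0"
  shows "light_reachable (vdist k) (graph_image (cover_morphism i) S) (vdist k z w) z w"
proof -
  obtain z' where z: "z' \<in> factorizations k \<alpha> (\<gamma> - \<alpha> i)" "z = cover_morphism i z'"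
    using factorization_cover_morphismE[OF assms(2,3)] .
  obtain w' where w: "w' \<in> factorizations k \<alpha> (\<gamma> - \<alpha> i)" "w = cover_morphism i w'"
    using factorization_cover_morphismE[OF assms(4,5)] .
  have "light_reachable (vdist k) S (vdist k z' w') z' w'"
    using min_weight_spanning_tree_imp_bottleneck_subgraph[OF assms(1)]
      light_reachable_catenary_graph[OF z(1) w(1)] by (rule bottleneck_subgraphD(3))
  then have "light_reachable (vdist k) (graph_image (cover_morphism i) S) (vdist k z' w')
      (cover_morphism i z') (cover_morphism i w')"
    by (rule light_reachable_graph_image) (simp add: vdist_cover_morphism)
  then show ?thesis by (simp add: z(2) w(2) vdist_cover_morphism)
qed

lemma light_reachable_overlapping_factorizations:
  assumes verts: "verts G = factorizations k \<alpha> \<gamma>"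
    and trees: "\<And>i. i < k \<Longrightarrow> diff_in \<gamma> (\<alpha> i) (fact_hom k \<alpha> ` nvec k) \<Longrightarrow>
      \<exists>S. min_weight_spanning_tree (vdist k) (catenary_graph k \<alpha> (\<gamma> - \<alpha> i)) S \<and>
          edges (graph_image (cover_morphism i) S) \<subseteq> edges G"
    and zw: "z \<in> factorizations k \<alpha> \<gamma>" "w \<in> factorizations k \<alpha> \<gamma>" "vgcd z w \<noteq> 0"
  shows "light_reachable (vdist k) G (vdist k z w) z w"
proof -
  obtain i where i: "z i > 0" "w i > 0" using zw(3) by (auto simp: vgcd_eq_zero_iff)
  note diff = positive_coordinate_imp_diff_in[OF zw(1) i(1)]
  obtain S where S: "min_weight_spanning_tree (vdist k) (catenary_graph k \<alpha> (\<gamma> - \<alpha> i)) S"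
    and edges: "edges (graph_image (cover_morphism i) S) \<subseteq> edges G"
    using trees[OF diff] by blast
  have "subgraph (graph_image (cover_morphism i) S) (catenary_graph k \<alpha> \<gamma>)"
    using S diff
    by (intro subgraph_cover_tree) (simp_all add: min_weight_spanning_tree_def diff_in_def)
  then have "subgraph (graph_image (cover_morphism i) S) G"
    using edges by (simp add: subgraph_def verts)
  with light_reachable_cover_tree[OF S zw(1) i(1) zw(2) i(2)] show ?thesis
    by (rule light_reachable_mono) simp
qed

lemma bottleneck_subgraph_catenary_graph:
  assumes nonzero: "0 \<notin> \<alpha> ` {..<k}"
    and verts: "verts G = factorizations k \<alpha> \<gamma>"
    and edges: "edges G \<subseteq> edges (catenary_graph k \<alpha> \<gamma>)"
    and graver_edges: "graver_edges k \<alpha> \<gamma> \<subseteq> edges G"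
    and overlapping: "\<And>z w. z \<in> factorizations k \<alpha> \<gamma> \<Longrightarrow> w \<in> factorizations k \<alpha> \<gamma> \<Longrightarrow>
      vgcd z w \<noteq> 0 \<Longrightarrow> light_reachable (vdist k) G (vdist k z w) z w"
  shows "bottleneck_subgraph (vdist k) G (catenary_graph k \<alpha> \<gamma>)"
proof (rule bottleneck_subgraphI)
  fix z w assume "{z, w} \<in> edges (catenary_graph k \<alpha> \<gamma>)"
  then have zw: "z \<in> factorizations k \<alpha> \<gamma>" "w \<in> factorizations k \<alpha> \<gamma>" "z \<noteq> w"
    by (simp_all add: doubleton_in_edges_catenary_graph_iff)
  consider (overlap) "vgcd z w \<noteq> 0" | (graver) "(z, w) \<in> graver_basis k \<alpha>"
    | (decomposable) "vgcd z w = 0" "(z, w) \<notin> graver_basis k \<alpha>"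
    by blast
  then show "light_reachable (vdist k) G (vdist k z w) z w"
  proof cases
    case overlap
    with zw(1,2) show ?thesis by (rule overlapping)
  next
    case graver
    then have "light_adjacent (vdist k) G (vdist k z w) z w"
      using zw graver_edges by (auto simp: light_adjacent_def verts graver_edges_def)
    then show ?thesis by (intro r_into_rtranclp)
  next
    case decomposable
    then obtain u where u: "u \<in> factorizations k \<alpha> \<gamma>" "vgcd z u \<noteq> 0" "vgcd u w \<noteq> 0"
      and dist: "vdist k z u \<le> vdist k z w" "vdist k u w \<le> vdist k z w"
      using disjoint_factorizations_intermediate[OF nonzero zw] by blast
    have "light_reachable (vdist k) G (vdist k z w) z u"
      using overlapping[OF zw(1) u(1,2)] subgraph_refl dist(1) by (rule light_reachable_mono)
    moreover have "light_reachable (vdist k) G (vdist k z w) u w"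
      using overlapping[OF u(1) zw(2) u(3)] subgraph_refl dist(2) by (rule light_reachable_mono)
    ultimately show ?thesis by (rule rtranclp_trans)
  qed
qed (simp_all add: verts edges)

theorem theorem4p10:
  fixes d k :: nat
    and \<Gamma> :: "(nat \<Rightarrow> nat) set"
    and \<alpha> :: "nat \<Rightarrow> nat \<Rightarrow> nat"
    and \<gamma> :: "nat \<Rightarrow> nat"
    and T :: "nat \<Rightarrow> (nat \<Rightarrow> nat) ugraph"
    and G' :: "(nat \<Rightarrow> nat) ugraph"
  assumes "affine_semigroup d \<Gamma>"
    and "inj_on \<alpha> {..<k}"
    and "minimal_generating_set (\<alpha> ` {..<k}) \<Gamma>"
    and "\<gamma> \<in> \<Gamma>"
    and "\<And>i. i < k \<Longrightarrow> diff_in \<gamma> (\<alpha> i) \<Gamma> \<Longrightarrow>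
           \<exists>S. min_weight_spanning_tree (vdist k) (catenary_graph k \<alpha> (\<gamma> - \<alpha> i)) S \<and>
               T i = graph_image (cover_morphism i) S"
    and "\<And>i. i < k \<Longrightarrow> \<not> diff_in \<gamma> (\<alpha> i) \<Gamma> \<Longrightarrow> edges (T i) = {}"
    and "G' = \<lparr>verts = factorizations k \<alpha> \<gamma>,
               edges = (\<Union>i<k. edges (T i)) \<union> graver_edges k \<alpha> \<gamma>\<rparr>"
  shows "connected_graph G' \<and>
         (\<forall>S. min_weight_spanning_tree (vdist k) G' S \<longrightarrow>
              min_weight_spanning_tree (vdist k) (catenary_graph k \<alpha> \<gamma>) S)"
proof -
  let ?K = "catenary_graph k \<alpha> \<gamma>"
  have \<Gamma>: "\<Gamma> = fact_hom k \<alpha> ` nvec k"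
    using assms(3) hull_generators_eq_fact_hom_image unfolding minimal_generating_set_def by metis
  have cover_edges: "edges (T i) \<subseteq> edges ?K" if "i < k" for i
    using assms(5,6)[OF that] subgraph_cover_tree that
    unfolding min_weight_spanning_tree_def diff_in_def subgraph_def by (metis empty_subsetI)
  have trees: "\<exists>S. min_weight_spanning_tree (vdist k) (catenary_graph k \<alpha> (\<gamma> - \<alpha> i)) S \<and>
      edges (graph_image (cover_morphism i) S) \<subseteq> edges G'" if "i < k" "diff_in \<gamma> (\<alpha> i) \<Gamma>" for i
    using assms(5)[OF that] that(1) by (fastforce simp: assms(7))
  have "bottleneck_subgraph (vdist k) G' ?K"
  proof (rule bottleneck_subgraph_catenary_graph)
    show "0 \<notin> \<alpha> ` {..<k}" using assms(3) by (rule zero_notin_minimal_generating_set)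
    show "edges G' \<subseteq> edges ?K"
      using cover_edges graver_edges_subset_catenary_graph by (auto simp: assms(7))
    show "light_reachable (vdist k) G' (vdist k z w) z w"
      if "z \<in> factorizations k \<alpha> \<gamma>" "w \<in> factorizations k \<alpha> \<gamma>" "vgcd z w \<noteq> 0" for z w
      using trees that unfolding \<Gamma>
      by (intro light_reachable_overlapping_factorizations) (simp_all add: assms(7))
  qed (simp_all add: assms(7))
  moreover have "connected_graph ?K"
    using assms(4) by (intro connected_catenary_graph) (auto simp: \<Gamma> factorizations_def)
  ultimately show ?thesis
    using connected_graph_if_bottleneck_subgraph min_weight_spanning_tree_if_bottleneck_subgraph
    by blast
qed

end
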